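(* For constant elements $X_m\in\mathcal K_m$, $m\ge0$, the transformations $\delta_{X_m}$ defined by $\delta_{X_m}\Theta=(\Theta X_m\Theta^{-1})_-\,\Theta$ (equivalently by $\delta_{X_m}A=[L,(\Theta X_m\Theta^{-1})_+]$) are symmetry transformations of the model defined by $L\Psi_0=0$ and $dL/dt_N=[L,B_N]$. That is: (i) $\delta_{X_m}A\in\mathcal M_0$ for every constant $X_m\in\mathcal K_m$, $m\ge 0$; (ii) each $\delta_{X_m}$ commutes with all isospectral flows: $\big(\delta_{X_m}\tfrac{d}{dt_N}-\tfrac{d}{dt_N}\delta_{X_m}\big)\Theta=0$ for every $N>0$; (iii) the transformations close into an algebra: for constant $X_m\in\mathcal K_m$, $X_n\in\mathcal K_n$ with $m,n\ge 0$, $\big(\delta_{X_m}\delta_{X_n}-\delta_{X_n}\delta_{X_m}\big)\Theta=\delta_{[X_m,X_n]}\Theta$.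
   Context: Algebra. $\widehat{\mathcal G}$ is an affine Lie algebra, realized by matrices depending on a loop parameter $\lambda$ (no central extension), with an integral gradation $\widehat{\mathcal G}=\bigoplus_{n\in\mathbb Z}\widehat{\mathcal G}_n$ given by a grading operator $Q_{\mathbf s}$: $[Q_{\mathbf s},Y]=nY$ for $Y\in\widehat{\mathcal G}_n$. Infinite sums over descending negative grades are allowed. For $Y=\sum_n Y_n$, $Y_n$ of grade $n$, put $(Y)_+=\sum_{n\ge 0}Y_n$, $(Y)_-=\sum_{n<0}Y_n$. $E\in\widehat{\mathcal G}_1$ is a constant semisimple element, so $\widehat{\mathcal G}=\mathcal K\oplus\mathcal M$ with $\mathcal K=\mathrm{Ker}(\mathrm{ad}\,E)$, $\mathcal M=\mathrm{Im}(\mathrm{ad}\,E)$; $\mathcal K_n=\mathcal K\cap\widehat{\mathcal G}_n$, $\mathcal M_n=\mathcal M\cap\widehat{\mathcal G}_n$. $\mathcal K$ is a subalgebra, not assumed abelian; $\mathcal C(\mathcal K)$ is its center and $\mathcal C_n(\mathcal K)=\mathcal C(\mathcal K)\cap\mathcal K_n$. "Constant" means independent of $x$ and of all flow parameters. Lax operator and dressing. $L=D_x+E+A$, where $D_x$ is differentiation $\partial_x$ (so $[L,Y]=\partial_xY+[E+A,Y]$) and $A=A(x)\in\mathcal M_0$. $\Theta=\exp\big(\sum_{l<0}\theta^{(l)}\big)$, with $\theta^{(l)}$ of grade $l$, is a dressing operator: $\Theta^{-1}(D_x+E+A)\Theta=D_x+E$, i.e. $\partial_x\Theta=\Theta E-(E+A)\Theta$.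 In particular $(\Theta E\Theta^{-1})_+=E+A$, so $A$ is determined by $\Theta$. Flows. Every $\delta_{X}$ acts as a derivation (Leibniz rule) vanishing on constant elements; its action on $A$ is the one induced from its action on $\Theta$; $\delta_X$ is linear in $X$. For each $N>0$ for which it exists, fix a constant $b_N\in\mathcal C_N(\mathcal K)$, with $b_1=E$; the isospectral flow is $\frac{d}{dt_N}=\delta_{b_N}$, i.e. $\frac{d}{dt_N}\Theta=(\Theta b_N\Theta^{-1})_-\Theta=\Theta b_N-B_N\Theta$ with $B_N=(\Theta b_N\Theta^{-1})_+$, and $\frac{d}{dt_1}=\partial_x$. *)

theory Defs
  imports "HOL-Analysis.Analysis" "HOL-Computational_Algebra.Formal_Laurent_Series"
begin

no_notation fps_nth (infixl "$" 75)

(* Fields take values in a commutative complex algebra of functions of x and of the flow parameters;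
   the image of of_complex consists of the functions independent of all of them. *)
class comm_complex_algebra = comm_ring_1 +
  fixes of_complex :: "complex \<Rightarrow> 'a"
  assumes of_complex_add: "of_complex (a + b) = of_complex a + of_complex b"
    and of_complex_mult: "of_complex (a * b) = of_complex a * of_complex b"
    and of_complex_1: "of_complex 1 = 1"
begin

lemma of_complex_0 [simp]: "of_complex 0 = 0"
  using of_complex_add[of 0 0] by simp

end

instantiation complex :: comm_complex_algebra
begin

definition of_complex_complex :: "complex \<Rightarrow> complex" where
  "of_complex_complex a = a"

instance by standard (simp_all add: of_complex_complex_def)

end

(* The formal variable of the Laurent series is 1 / lambda, so the coefficient of lambda ^ k sits at
   index - k, and the series may have infinitely many negative powers of lambda. *)
type_synonym ('a, 'n) loop = "'a fls ^ 'n ^ 'n"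

definition loop_coeff :: "('a::zero, 'n::finite) loop \<Rightarrow> int \<Rightarrow> 'a ^ 'n ^ 'n" where
  "loop_coeff Y k = (\<chi> i j. fls_nth (Y $ i $ j) (- k))"

definition lie :: "'a::ring_1 ^ 'n ^ 'n \<Rightarrow> 'a ^ 'n ^ 'n \<Rightarrow> 'a ^ 'n ^ 'n" where
  "lie X Y = X ** Y - Y ** X"

definition mscale :: "'a::times \<Rightarrow> 'a ^ 'n ^ 'n \<Rightarrow> 'a ^ 'n ^ 'n" where
  "mscale c X = (\<chi> i j. c * X $ i $ j)"

definition map_loop :: "('a::zero \<Rightarrow> 'b::zero) \<Rightarrow> ('a, 'n::finite) loop \<Rightarrow> ('b, 'n) loop" where
  "map_loop f Y = (\<chi> i j. Abs_fls (\<lambda>k. f (fls_nth (Y $ i $ j) k)))"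

lemma map_loop_nth [simp]:
  "f 0 = 0 \<Longrightarrow> fls_nth (map_loop f Y $ i $ j) k = f (fls_nth (Y $ i $ j) k)"
  unfolding map_loop_def
  by (simp, rule nth_Abs_fls_lower_bound[of "fls_subdegree (Y $ i $ j)"]) simp

abbreviation cst :: "(complex, 'n::finite) loop \<Rightarrow> ('a::comm_complex_algebra, 'n) loop" where
  "cst \<equiv> map_loop of_complex"

definition lie_algebra :: "(complex ^ 'n::finite ^ 'n) set \<Rightarrow> bool" where
  "lie_algebra g \<longleftrightarrow> 0 \<in> g \<and>
     (\<forall>X\<in>g. \<forall>Y\<in>g. X + Y \<in> g \<and> lie X Y \<in> g) \<and> (\<forall>c. \<forall>X\<in>g. mscale c X \<in> g)"

definition lie_ideal :: "(complex ^ 'n::finite ^ 'n) set \<Rightarrow> (complex ^ 'n ^ 'n) set \<Rightarrow> bool" where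
  "lie_ideal I g \<longleftrightarrow> I \<subseteq> g \<and> lie_algebra I \<and> (\<forall>X\<in>g. \<forall>Y\<in>I. lie X Y \<in> I)"

definition simple_lie_algebra :: "(complex ^ 'n::finite ^ 'n) set \<Rightarrow> bool" where
  "simple_lie_algebra g \<longleftrightarrow> lie_algebra g \<and> (\<exists>X\<in>g. \<exists>Y\<in>g. lie X Y \<noteq> 0) \<and>
     (\<forall>I. lie_ideal I g \<longrightarrow> I = {0} \<or> I = g)"

definition finite_order_aut ::
    "(complex ^ 'n::finite ^ 'n) set \<Rightarrow> (complex ^ 'n ^ 'n \<Rightarrow> complex ^ 'n ^ 'n) \<Rightarrow> nat \<Rightarrow> bool" where
  "finite_order_aut g \<sigma> r \<longleftrightarrow> r > 0 \<and> (\<forall>X\<in>g. \<sigma> X \<in> g \<and> (\<sigma> ^^ r) X = X) \<and>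
     (\<forall>X\<in>g. \<forall>Y\<in>g. \<sigma> (X + Y) = \<sigma> X + \<sigma> Y \<and> \<sigma> (lie X Y) = lie (\<sigma> X) (\<sigma> Y)) \<and>
     (\<forall>c. \<forall>X\<in>g. \<sigma> (mscale c X) = mscale c (\<sigma> X))"

(* Every affine algebra without its central extension and derivation is a loop algebra of a simple
   Lie algebra fin_alg of matrices, twisted by an automorphism twist with twist ^^ twist_ord = id
   (untwisted case: twist = id, twist_ord = 1). The grading operator is
   Q_s = loop_deg * lambda d/dlambda + diag cartan; the basis of the matrix realization is chosen so
   that the Cartan part of Q_s is diagonal. *)
record 'n affine =
  fin_alg :: "(complex ^ 'n ^ 'n) set"
  twist :: "complex ^ 'n ^ 'n \<Rightarrow> complex ^ 'n ^ 'n"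
  twist_ord :: nat
  loop_deg :: real
  cartan :: "'n \<Rightarrow> real"

definition twist_eigenspace :: "'n::finite affine \<Rightarrow> int \<Rightarrow> (complex ^ 'n ^ 'n) set" where
  "twist_eigenspace G k =
     {X \<in> fin_alg G. twist G X = mscale (cis (2 * pi * of_int k / of_nat (twist_ord G))) X}"

definition coeff_span ::
    "(complex ^ 'n::finite ^ 'n) set \<Rightarrow> ('a::comm_complex_algebra ^ 'n ^ 'n) set" where
  "coeff_span S = {\<Sum>X\<in>F. mscale (f X) (\<chi> i j. of_complex (X $ i $ j)) | F f. finite F \<and> F \<subseteq> S}"

(* For 'a = complex this is the affine algebra itself (its constant elements); for a function
   algebra 'a it is the algebra of fields with values in it. *)
definition Ghat :: "'n::finite affine \<Rightarrow> ('a::comm_complex_algebra, 'n) loop set" where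
  "Ghat G = {Y. \<forall>k. loop_coeff Y k \<in> coeff_span (twist_eigenspace G k)}"

(* [Q_s, Y]; in terms of X = 1 / lambda, lambda d/dlambda is - X d/dX. *)
definition ad_Q :: "'n::finite affine \<Rightarrow> ('a::comm_complex_algebra, 'n) loop \<Rightarrow> ('a, 'n) loop" where
  "ad_Q G Y =
     (\<chi> i j. fls_const (of_complex (of_real (loop_deg G))) * - (fls_X * fls_deriv (Y $ i $ j)))
     + lie (\<chi> i j. if i = j then fls_const (of_complex (of_real (cartan G i))) else 0) Y"

definition grade_space ::
    "'n::finite affine \<Rightarrow> int \<Rightarrow> ('a::comm_complex_algebra, 'n) loop set" where
  "grade_space G n = {Y \<in> Ghat G. ad_Q G Y = mscale (of_int n) Y}"

(* Q_s-eigenvalue of lambda ^ k times the matrix unit with entry 1 in row i, column j. *)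
definition unit_grade :: "'n::finite affine \<Rightarrow> int \<Rightarrow> 'n \<Rightarrow> 'n \<Rightarrow> real" where
  "unit_grade G k i j = loop_deg G * of_int k + cartan G i - cartan G j"

(* The sum of the components of Y with grade in S. *)
definition grade_part :: "'n::finite affine \<Rightarrow> real set \<Rightarrow> ('a::zero, 'n) loop \<Rightarrow> ('a, 'n) loop" where
  "grade_part G S Y =
     (\<chi> i j. Abs_fls (\<lambda>k. if unit_grade G (- k) i j \<in> S then fls_nth (Y $ i $ j) k else 0))"

abbreviation pos_part :: "'n::finite affine \<Rightarrow> ('a::zero, 'n) loop \<Rightarrow> ('a, 'n) loop" where
  "pos_part G \<equiv> grade_part G {0..}"

abbreviation neg_part :: "'n::finite affine \<Rightarrow> ('a::zero, 'n) loop \<Rightarrow> ('a, 'n) loop" where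
  "neg_part G \<equiv> grade_part G {..<0}"

(* The last two conditions: every Y in Ghat is the sum of its components of integral grade, and
   these lie in Ghat. With loop_deg > 0, sums over descending grades are exactly the series with
   powers of lambda bounded above. *)
definition graded_affine :: "'n::finite affine \<Rightarrow> bool" where
  "graded_affine G \<longleftrightarrow> simple_lie_algebra (fin_alg G) \<and>
     finite_order_aut (fin_alg G) (twist G) (twist_ord G) \<and> loop_deg G > 0 \<and>
     (\<forall>Y \<in> (Ghat G :: (complex, 'n) loop set).
        (\<forall>n. grade_part G {of_int n} Y \<in> grade_space G n) \<and> grade_part G \<int> Y = Y)"

lemma grade_part_nth [simp]:
  "fls_nth (grade_part G S Y $ i $ j) k =
     (if unit_grade G (- k) i j \<in> S then fls_nth (Y $ i $ j) k else 0)"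
  unfolding grade_part_def vec_lambda_beta
  by (rule nth_Abs_fls_lower_bound[of "fls_subdegree (Y $ i $ j)"]) simp

lemma ad_Q_nth:
  "fls_nth (ad_Q G Y $ i $ j) k = of_complex (of_real (unit_grade G (- k) i j)) * fls_nth (Y $ i $ j) k"
proof -
  define c where "c a = (of_complex (of_real a) :: 'a)" for a
  have c_add: "c (x + y) = c x + c y" and c_mult: "c (x * y) = c x * c y" for x y
    by (simp_all add: c_def of_complex_add of_complex_mult)
  have c_minus: "c (- x) = - c x" for x
    using c_add[of x "- x"] by (simp add: c_def eq_neg_iff_add_eq_0 add.commute)
  have c_nat: "c (of_nat n) = of_nat n" for n
    by (induction n) (simp_all add: c_add, simp_all add: c_def of_complex_1)
  have c_int: "c (of_int n) = of_int n" for n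
    by (cases n) (simp_all add: c_nat c_minus del: of_nat_Suc)
  have "fls_nth (ad_Q G Y $ i $ j) k =
      c (loop_deg G) * - (of_int k * fls_nth (Y $ i $ j) k)
      + (c (cartan G i) * fls_nth (Y $ i $ j) k - fls_nth (Y $ i $ j) k * c (cartan G j))"
    by (simp add: ad_Q_def lie_def c_def[symmetric] matrix_matrix_mult_def if_distrib
          if_distribR fls_X_times_conv_shift cong: if_cong)
  also have "\<dots> = c (unit_grade G (- k) i j) * fls_nth (Y $ i $ j) k"
    by (simp only: unit_grade_def diff_conv_add_uminus c_add c_mult c_minus c_int of_int_minus)
       (simp add: algebra_simps)
  finally show ?thesis by (simp add: c_def)
qed

lemma pos_part_plus_neg_part: "pos_part G Y + neg_part G Y = Y"
  by (auto simp: vec_eq_iff fls_eq_iff)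

(* Used for homogeneous E only, for which the sum is finite since loop_deg > 0. *)
definition loop_eval :: "(complex, 'n::finite) loop \<Rightarrow> complex \<Rightarrow> complex ^ 'n ^ 'n" where
  "loop_eval Y z = (\<Sum>k | loop_coeff Y k \<noteq> 0. mscale (z powi k) (loop_coeff Y k))"

(* For every value z of the loop parameter, ad (E z) is diagonalizable on the finite algebra.
   The set of eigenvectors is stable under complex scaling, so its real span is its complex span. *)
definition semisimple_elem :: "'n::finite affine \<Rightarrow> (complex, 'n) loop \<Rightarrow> bool" where
  "semisimple_elem G E \<longleftrightarrow> (\<forall>z. z \<noteq> 0 \<longrightarrow>
     fin_alg G \<subseteq> span {Y \<in> fin_alg G. \<exists>a. lie (loop_eval E z) Y = mscale a Y})"

definition Ker_ad :: "'n::finite affine \<Rightarrow> (complex, 'n) loop \<Rightarrow> (complex, 'n) loop set" where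
  "Ker_ad G E = {Y \<in> Ghat G. lie E Y = 0}"

definition Im_ad ::
    "'n::finite affine \<Rightarrow> (complex, 'n) loop \<Rightarrow> ('a::comm_complex_algebra, 'n) loop set" where
  "Im_ad G E = lie (cst E) ` Ghat G"

definition K_space :: "'n::finite affine \<Rightarrow> (complex, 'n) loop \<Rightarrow> int \<Rightarrow> (complex, 'n) loop set" where
  "K_space G E n = Ker_ad G E \<inter> grade_space G n"

definition M_space ::
    "'n::finite affine \<Rightarrow> (complex, 'n) loop \<Rightarrow> int \<Rightarrow> ('a::comm_complex_algebra, 'n) loop set" where
  "M_space G E n = Im_ad G E \<inter> grade_space G n"

definition center_space ::
    "'n::finite affine \<Rightarrow> (complex, 'n) loop \<Rightarrow> int \<Rightarrow> (complex, 'n) loop set" where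
  "center_space G E n = {X \<in> K_space G E n. \<forall>Y \<in> Ker_ad G E. lie X Y = 0}"

(* The direct sum of the K_m with m >= 0: powers of lambda are bounded above, hence so are grades. *)
definition K_nonneg :: "'n::finite affine \<Rightarrow> (complex, 'n) loop \<Rightarrow> (complex, 'n) loop set" where
  "K_nonneg G E = {X \<in> Ker_ad G E. pos_part G X = X}"

definition loop_pow :: "('a::comm_ring_1, 'n::finite) loop \<Rightarrow> nat \<Rightarrow> ('a, 'n) loop" where
  "loop_pow Y p = (((**) Y) ^^ p) (mat 1)"

(* \<Theta> = exp \<theta> for \<theta> of negative grade: only finitely many powers of \<theta> contribute to each coefficient. *)
definition is_exp :: "('a::comm_complex_algebra, 'n::finite) loop \<Rightarrow> ('a, 'n) loop \<Rightarrow> bool" where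
  "is_exp \<theta> \<Theta> \<longleftrightarrow> (\<forall>i j k. \<forall>\<^sub>F P in sequentially. fls_nth (\<Theta> $ i $ j) k =
     (\<Sum>p<P. of_complex (1 / fact p) * fls_nth (loop_pow \<theta> p $ i $ j) k))"

definition dressing_op :: "'n::finite affine \<Rightarrow> ('a::comm_complex_algebra, 'n) loop \<Rightarrow> bool" where
  "dressing_op G \<Theta> \<longleftrightarrow> (\<exists>\<theta>\<in>Ghat G. neg_part G \<theta> = \<theta> \<and> is_exp \<theta> \<Theta>)"

(* Derivations act on loops coefficientwise, by map_loop. *)
definition is_derivation :: "('a::comm_complex_algebra \<Rightarrow> 'a) \<Rightarrow> bool" where
  "is_derivation d \<longleftrightarrow> (\<forall>u v. d (u + v) = d u + d v) \<and> (\<forall>u v. d (u * v) = d u * v + u * d v) \<and>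
     (\<forall>c. d (of_complex c) = 0)"

definition conj_by ::
    "('a::comm_complex_algebra, 'n::finite) loop \<Rightarrow> (complex, 'n) loop \<Rightarrow> ('a, 'n) loop" where
  "conj_by \<Theta> X = \<Theta> ** cst X ** matrix_inv \<Theta>"

(* [L, Y] for L = D_x + E + A, where D is the derivation with respect to x. *)
definition lax_bracket ::
    "('a::comm_complex_algebra \<Rightarrow> 'a) \<Rightarrow> (complex, 'n::finite) loop \<Rightarrow> ('a, 'n) loop \<Rightarrow>
     ('a, 'n) loop \<Rightarrow> ('a, 'n) loop" where
  "lax_bracket D E A Y = map_loop D Y + lie (cst E + A) Y"

end

theory Submission
  imports Defs
begin

text \<open>
  Write \<open>Z\<^sub>X = \<Theta> X \<Theta>\<inverse> = B\<^sub>X + N\<^sub>X\<close> for the splitting into nonnegative and negative grades.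
  Since \<open>\<delta>\<^sub>X \<Theta> = N\<^sub>X \<Theta>\<close>, one has \<open>\<delta>\<^sub>X Z\<^sub>Y = [N\<^sub>X, Z\<^sub>Y]\<close>, and the dressing equation says that
  \<open>D\<close> is the flow of \<open>E\<close> with \<open>B\<^sub>E = E + A\<close>. Splitting the grades of
  \<open>[Z\<^sub>X, Z\<^sub>Y] = Z\<^sub>[\<^sub>X\<^sub>,\<^sub>Y\<^sub>]\<close>, the negative part gives the commutator of two flows, hence closure, and
  commutation with the flows of central elements; the nonnegative part for \<open>Y = E\<close>, where
  \<open>[Z\<^sub>X, Z\<^sub>E] = 0\<close>, gives \<open>\<delta>\<^sub>X A = \<delta>\<^sub>X B\<^sub>E = [L, B\<^sub>X]\<close>. Finally \<open>A = [E, W]\<close> implies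
  \<open>\<delta>\<^sub>X A = [E, \<delta>\<^sub>X W]\<close>, and derivations preserve grades.
\<close>

section \<open>Matrices over a ring\<close>

lemma matrix_mult_add_left: "(A + B) ** C = A ** C + B ** (C :: 'a::ring_1 ^ 'p ^ 'm)"
  by (simp add: vec_eq_iff matrix_matrix_mult_def sum.distrib distrib_right)

lemma matrix_mult_diff_left: "(A - B) ** C = A ** C - B ** (C :: 'a::ring_1 ^ 'p ^ 'm)"
  by (simp add: vec_eq_iff matrix_matrix_mult_def sum_subtractf left_diff_distrib)

lemma matrix_mult_diff_right: "A ** (B - C) = A ** B - A ** (C :: 'a::ring_1 ^ 'p ^ 'm)"
  by (simp add: vec_eq_iff matrix_matrix_mult_def sum_subtractf right_diff_distrib)

lemma matrix_mult_uminus_left: "(- A) ** B = - (A ** (B :: 'a::ring_1 ^ 'p ^ 'm))"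
  by (simp add: vec_eq_iff matrix_matrix_mult_def sum_negf)

lemma matrix_mult_uminus_right: "A ** (- B) = - (A ** (B :: 'a::ring_1 ^ 'p ^ 'm))"
  by (simp add: vec_eq_iff matrix_matrix_mult_def sum_negf)

lemma matrix_mult_0: "A ** 0 = 0" "0 ** A = 0" for A :: "'a::ring_1 ^ 'm ^ 'n"
  by (simp_all add: vec_eq_iff matrix_matrix_mult_def)

lemmas matrix_ring_simps = matrix_add_ldistrib matrix_mult_add_left matrix_mult_diff_left
  matrix_mult_diff_right matrix_mult_uminus_left matrix_mult_uminus_right matrix_mult_0
  matrix_mul_assoc

lemma lie_add_left: "lie (X + Y) Z = lie X Z + lie Y Z"
  and lie_add_right: "lie X (Y + Z) = lie X Y + lie X Z"
  and lie_0: "lie X 0 = 0" "lie 0 X = 0"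
  and lie_skew: "lie Y X = - lie X Y"
  and lie_jacobi: "lie X (lie Y Z) = lie (lie X Y) Z + lie Y (lie X Z)"
  by (simp_all add: lie_def matrix_ring_simps algebra_simps)

lemma matrix_mult_mscale:
  fixes X :: "'a::comm_ring_1 ^ 'n ^ 'n"
  shows "mscale c X ** Y = mscale c (X ** Y)" "X ** mscale c Y = mscale c (X ** Y)"
  by (simp_all add: vec_eq_iff mscale_def matrix_matrix_mult_def sum_distrib_left ac_simps)

lemma mscale_diff: "mscale c (X - Y) = mscale c X - mscale (c :: 'a::comm_ring_1) Y"
  by (simp add: vec_eq_iff mscale_def algebra_simps)

lemma lie_mscale:
  fixes X :: "'a::comm_ring_1 ^ 'n ^ 'n"
  shows "lie (mscale c X) (mscale d Y) = mscale (c * d) (lie X Y)"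
  by (simp add: lie_def matrix_mult_mscale mscale_diff)
     (simp add: vec_eq_iff mscale_def ac_simps)

lemma invertible_matrix_inv:
  fixes A :: "'a::semiring_1 ^ 'n ^ 'm"
  assumes "invertible A"
  shows "A ** matrix_inv A = mat 1" "matrix_inv A ** A = mat 1"
  using someI_ex[OF assms[unfolded invertible_def]] by (simp_all add: matrix_inv_def)

section \<open>Grades\<close>

text \<open>The Cartan part of the grading operator is diagonal, so every power of lambda times a
  matrix unit is homogeneous and a restriction on grades is an entrywise vanishing condition. Reals
  are used because single matrix units may have non-integral grade.\<close>

definition graded_in :: "'n::finite affine \<Rightarrow> real set \<Rightarrow> ('a::zero, 'n) loop \<Rightarrow> bool" where
  "graded_in G S Y \<longleftrightarrow> (\<forall>i j k. unit_grade G (- k) i j \<notin> S \<longrightarrow> fls_nth (Y $ i $ j) k = 0)"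

lemma graded_in_mono: "graded_in G S Y \<Longrightarrow> S \<subseteq> T \<Longrightarrow> graded_in G T Y"
  by (auto simp: graded_in_def)

lemma graded_in_grade_part: "graded_in G S (grade_part G S Y)"
  by (simp add: graded_in_def)

lemma graded_in_iff: "graded_in G S Y \<longleftrightarrow> grade_part G S Y = Y"
  by (auto simp: graded_in_def vec_eq_iff fls_eq_iff)

lemma grade_part_eq_0: "graded_in G T Y \<Longrightarrow> S \<inter> T = {} \<Longrightarrow> grade_part G S Y = 0"
  by (auto simp: graded_in_def vec_eq_iff fls_eq_iff)

lemma grade_part_add: "grade_part G S (Y + Z) = grade_part G S Y + grade_part G S (Z :: ('a::ring_1, _) loop)"
  and grade_part_diff: "grade_part G S (Y - Z) = grade_part G S Y - grade_part G S (Z :: ('a::ring_1, _) loop)"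
  and grade_part_0: "grade_part G S 0 = (0 :: ('a::ring_1, _) loop)"
  by (simp_all add: vec_eq_iff fls_eq_iff)

lemma graded_in_add: "graded_in G S Y \<Longrightarrow> graded_in G S Z \<Longrightarrow> graded_in G S (Y + Z)"
  and graded_in_diff: "graded_in G S Y \<Longrightarrow> graded_in G S Z \<Longrightarrow> graded_in G S (Y - Z)"
  and graded_in_uminus: "graded_in G S Y \<Longrightarrow> graded_in G S (- Y)"
  and graded_in_0: "graded_in G S 0"
  for Y Z :: "('a::ring_1, 'n::finite) loop"
  by (simp_all add: graded_in_def)

lemma unit_grade_add: "unit_grade G k i m + unit_grade G l m j = unit_grade G (k + l) i j"
  by (simp add: unit_grade_def algebra_simps)

lemma graded_in_mat_1: "graded_in G {0} (mat 1 :: ('a::comm_ring_1, 'n::finite) loop)"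
  by (auto simp: graded_in_def mat_def unit_grade_def)

text \<open>By \<open>unit_grade_add\<close> the Cartan term of the intermediate index cancels, so
  grades add along each summand of the convolution: a summand outside \<open>U\<close> must have a
  factor outside \<open>S\<close> or \<open>T\<close>.\<close>

lemma graded_in_mult:
  fixes Y Z :: "('a::comm_ring_1, 'n::finite) loop"
  assumes "graded_in G S Y" "graded_in G T Z" and U: "\<And>s t. s \<in> S \<Longrightarrow> t \<in> T \<Longrightarrow> s + t \<in> U"
  shows "graded_in G U (Y ** Z)"
proof -
  have "fls_nth ((Y ** Z) $ i $ j) k = 0" if k: "unit_grade G (- k) i j \<notin> U" for i j k
  proof -
    have "fls_nth (Y $ i $ m) l * fls_nth (Z $ m $ j) (k - l) = 0" for m l
    proof (cases "unit_grade G (- l) i m \<in> S")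
      case True
      with U[of "unit_grade G (- l) i m" "unit_grade G (- (k - l)) m j"] k
      have "unit_grade G (- (k - l)) m j \<notin> T"
        by (auto simp: unit_grade_add)
      then show ?thesis
        using assms(2) by (simp add: graded_in_def)
    qed (use assms(1) in \<open>simp add: graded_in_def\<close>)
    then show ?thesis
      by (simp add: matrix_matrix_mult_def fls_nth_sum fls_times_nth(2))
  qed
  then show ?thesis
    by (simp add: graded_in_def)
qed

lemma graded_in_lie:
  fixes Y Z :: "('a::comm_ring_1, 'n::finite) loop"
  assumes "graded_in G S Y" "graded_in G T Z" and "\<And>s t. s \<in> S \<Longrightarrow> t \<in> T \<Longrightarrow> s + t \<in> U"
  shows "graded_in G U (lie Y Z)"
proof -
  have "graded_in G U (Z ** Y)"
    by (rule graded_in_mult[OF assms(2,1)]) (metis assms(3) add.commute)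
  then show ?thesis
    unfolding lie_def by (intro graded_in_diff graded_in_mult[OF assms])
qed

lemma graded_in_loop_pow:
  fixes Y :: "('a::comm_ring_1, 'n::finite) loop"
  assumes "graded_in G {..<0} Y" "p > 0"
  shows "graded_in G {..<0} (loop_pow Y p)"
  using assms(2)
proof (induction p rule: nat_induct_non_zero)
  case 1
  show ?case
    using assms(1) by (simp add: loop_pow_def)
next
  case (Suc n)
  have "graded_in G {..<0} (Y ** loop_pow Y n)"
    by (rule graded_in_mult[OF assms(1) Suc.IH]) auto
  then show ?case
    by (simp add: loop_pow_def)
qed

lemma of_complex_minus: "of_complex (- a) = - (of_complex a :: 'a::comm_complex_algebra)"
  using of_complex_add[of "- a" a] by (simp add: eq_neg_iff_add_eq_0)

lemma of_complex_of_int: "of_complex (of_int n) = (of_int n :: 'a::comm_complex_algebra)"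
proof -
  have nat: "of_complex (of_nat n) = (of_nat n :: 'a)" for n
    by (induction n) (simp_all add: of_complex_add of_complex_1)
  show ?thesis
    by (cases n rule: int_diff_cases)
       (simp add: diff_conv_add_uminus of_complex_add of_complex_minus nat
         del: add_uminus_conv_diff)
qed

text \<open>\<open>ad_Q\<close> multiplies each coefficient by its real grade. The coefficient ring
  may have zero divisors, but a nonzero complex constant is a unit in it, so a coefficient of
  another grade must vanish.\<close>

lemma ad_Q_eq_iff:
  fixes Y :: "('a::comm_complex_algebra, 'n::finite) loop"
  shows "ad_Q G Y = mscale (of_int n) Y \<longleftrightarrow> graded_in G {of_int n} Y"
proof -
  have "of_complex (of_real u) * y = of_int n * y \<longleftrightarrow> u = of_int n \<or> y = 0"
    for u and y :: 'a
  proof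
    assume eq: "of_complex (of_real u) * y = of_int n * y"
    show "u = of_int n \<or> y = 0"
    proof (rule disjCI)
      assume "y \<noteq> 0"
      show "u = of_int n"
      proof (rule ccontr)
        assume u: "u \<noteq> of_int n"
        define c :: complex where "c = of_real u - of_int n"
        have "c \<noteq> 0"
          using u by (simp add: c_def complex_eq_iff)
        have "of_complex c * y = 0"
          using eq by (simp add: c_def of_complex_add of_complex_minus of_complex_of_int
            diff_conv_add_uminus algebra_simps del: add_uminus_conv_diff)
        then have "of_complex (inverse c * c) * y = 0"
          by (simp add: of_complex_mult mult.assoc)
        with \<open>c \<noteq> 0\<close> \<open>y \<noteq> 0\<close> show False
          by (simp add: of_complex_1)
      qed
    qed
  qed (auto simp: of_complex_of_int)
  moreover have "fls_nth (of_int n * f) k = of_int n * fls_nth f k" for f :: "'a fls" and k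
    by (simp add: fls_of_int)
  ultimately show ?thesis
    by (simp add: vec_eq_iff fls_eq_iff ad_Q_nth mscale_def graded_in_def) blast
qed

lemma grade_space_iff: "Y \<in> grade_space G n \<longleftrightarrow> Y \<in> Ghat G \<and> graded_in G {of_int n} Y"
  by (simp add: grade_space_def ad_Q_eq_iff)

section \<open>Invertibility of dressing operators\<close>

text \<open>For fixed \<open>i\<close>, \<open>j\<close> the grades form an arithmetic progression
  of step \<open>loop_deg G\<close>, which has a largest negative member; there are only finitely
  many pairs \<open>i\<close>, \<open>j\<close>.\<close>

lemma unit_grade_gap:
  fixes G :: "'n::finite affine"
  assumes "loop_deg G > 0"
  obtains e where "e > 0" "\<And>k i j. unit_grade G k i j < 0 \<Longrightarrow> unit_grade G k i j \<le> - e"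
proof -
  \<comment> \<open>\<open>v (i, j)\<close> is the largest negative grade at this entry: ceiling
    minus one is the largest integer strictly below the point where the grade vanishes.\<close>
  define v where "v p = (case p of (i, j) \<Rightarrow>
    unit_grade G (\<lceil>(cartan G j - cartan G i) / loop_deg G\<rceil> - 1) i j)" for p :: "'n \<times> 'n"
  have le: "unit_grade G k i j \<le> v (i, j)" if "unit_grade G k i j < 0" for k i j
  proof -
    have "of_int k < (cartan G j - cartan G i) / loop_deg G"
      using that assms by (simp add: unit_grade_def field_simps)
    then have "k \<le> \<lceil>(cartan G j - cartan G i) / loop_deg G\<rceil> - 1"
      by linarith
    then show ?thesis
      using assms by (simp add: unit_grade_def v_def del: of_int_diff)
  qed
  have neg: "v (i, j) < 0" for i j
  proof -
    have "of_int (\<lceil>(cartan G j - cartan G i) / loop_deg G\<rceil> - 1) < (cartan G j - cartan G i) / loop_deg G"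
      by linarith
    then show ?thesis
      using assms unfolding unit_grade_def v_def by (simp add: field_simps)
  qed
  define m where "m = Max (range v)"
  have "m < 0"
    using neg by (auto simp: m_def)
  moreover have "unit_grade G k i j \<le> m" if "unit_grade G k i j < 0" for k i j
    unfolding m_def by (rule order_trans[OF le[OF that]]) simp
  ultimately show ?thesis
    using that[of "- m"] by simp
qed

text \<open>The grade filtration is separated: each coefficient has one fixed grade, which exceeds
  \<open>- (real P * e)\<close> for large \<open>P\<close>. Identities between limits can thus be
  checked modulo ever lower grades.\<close>

lemma loop_eq_0_if_arbitrarily_negative:
  fixes Y :: "('a::comm_ring_1, 'n::finite) loop"
  assumes "e > 0" "\<And>P::nat. graded_in G {..- (real P * e)} Y"
  shows "Y = 0"
proof -
  have "fls_nth (Y $ i $ j) k = 0" for i j k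
  proof -
    obtain P :: nat where "- unit_grade G (- k) i j < real P * e"
      using reals_Archimedean3[OF assms(1)] by blast
    then show ?thesis
      using assms(2)[of P] by (auto simp: graded_in_def)
  qed
  then show ?thesis
    by (simp add: vec_eq_iff fls_eq_iff)
qed

text \<open>The solution of \<open>Z = 1 - M Z\<close> is the limit of the iteration from 0; each step gains \<open>e\<close> in grade.\<close>

lemma right_inverse_one_plus_negative:
  fixes M :: "('a::comm_ring_1, 'n::finite) loop"
  assumes deg: "loop_deg G > 0" and M: "graded_in G {..<0} M"
  obtains S where "(mat 1 + M) ** S = mat 1" "graded_in G {..<0} (S - mat 1)"
proof -
  obtain e where e: "e > 0" "\<And>k i j. unit_grade G k i j < 0 \<Longrightarrow> unit_grade G k i j \<le> - e"
    using unit_grade_gap[OF deg] by blast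
  \<comment> \<open>Strict negativity alone would not make the iteration converge; the uniform gap
    \<open>e\<close> does.\<close>
  have M': "graded_in G {..- e} M"
    unfolding graded_in_def
  proof (intro allI impI)
    fix i j k assume "unit_grade G (- k) i j \<notin> {..- e}"
    then have "\<not> unit_grade G (- k) i j < 0"
      using e(2) by force
    then show "fls_nth (M $ i $ j) k = 0"
      using M by (simp add: graded_in_def)
  qed
  define Z where "Z P = ((\<lambda>Y. mat 1 - M ** Y) ^^ P) 0" for P :: nat
  have Z_Suc: "Z (Suc P) = mat 1 - M ** Z P" for P
    by (simp add: Z_def)
  have step: "graded_in G {..- (real P * e)} (Z (Suc P) - Z P)" for P
  proof (induction P)
    case 0
    show ?case
      using graded_in_mono[OF graded_in_mat_1, of "{..0}" G] by (simp add: Z_def matrix_mult_0)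
  next
    case (Suc P)
    have "graded_in G {..- (real (Suc P) * e)} (M ** (Z (Suc P) - Z P))"
      by (rule graded_in_mult[OF M' Suc.IH]) (auto simp: algebra_simps)
    moreover have "Z (Suc (Suc P)) - Z (Suc P) = - (M ** (Z (Suc P) - Z P))"
      by (subst (2) Z_Suc, subst Z_Suc) (simp add: matrix_mult_diff_right)
    ultimately show ?case
      by (simp only: graded_in_uminus)
  qed
  have tail: "graded_in G {..- (real P * e)} (Z (P + Q) - Z P)" for P Q
  proof (induction Q)
    case 0
    show ?case by (simp add: graded_in_0)
  next
    case (Suc Q)
    have "graded_in G {..- (real P * e)} (Z (Suc (P + Q)) - Z (P + Q))"
      by (rule graded_in_mono[OF step]) (use e(1) in auto)
    from graded_in_add[OF this Suc.IH] show ?case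
      by simp
  qed
  have stable: "fls_nth (Z Q $ i $ j) k = fls_nth (Z P $ i $ j) k"
    if "- unit_grade G (- k) i j < real P * e" "P \<le> Q" for P Q i j k
    using tail[of P "Q - P"] that by (auto simp: graded_in_def)
  \<comment> \<open>A stage from which the iterates no longer change at this coefficient, by
    \<open>stable\<close>; the limit \<open>S\<close> reads each coefficient at its own
    stage.\<close>
  define p where "p i j k = (SOME P::nat. - unit_grade G (- k) i j < real P * e)" for i j k
  have p: "- unit_grade G (- k) i j < real (p i j k) * e" for i j k
    unfolding p_def by (rule someI_ex) (use reals_Archimedean3[OF e(1)] in blast)
  define S :: "('a, 'n) loop" where
    "S = (\<chi> i j. Abs_fls (\<lambda>k. fls_nth (Z (p i j k) $ i $ j) k))"
  \<comment> \<open>This bounds the powers of lambda uniformly in \<open>P\<close>, so the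
    coefficients chosen for \<open>S\<close> do form Laurent series.\<close>
  have Z_nonpos: "graded_in G {..0} (Z P)" for P
    using tail[of 0 P] by (simp add: Z_def)
  have S_nth: "fls_nth (S $ i $ j) k = fls_nth (Z (p i j k) $ i $ j) k" for i j k
    unfolding S_def vec_lambda_beta
  proof (rule nth_Abs_fls_lower_bound[of "\<lfloor>(cartan G i - cartan G j) / loop_deg G\<rfloor>"], intro allI impI)
    fix l assume "l < \<lfloor>(cartan G i - cartan G j) / loop_deg G\<rfloor>"
    then have "of_int l < (cartan G i - cartan G j) / loop_deg G"
      by linarith
    then have "unit_grade G (- l) i j > 0"
      using deg by (simp add: unit_grade_def field_simps)
    then show "fls_nth (Z (p i j l) $ i $ j) l = 0"
      using Z_nonpos by (simp add: graded_in_def)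
  qed
  have S_Z: "graded_in G {..- (real P * e)} (S - Z P)" for P
  proof -
    have "fls_nth (S $ i $ j) k = fls_nth (Z P $ i $ j) k"
      if "unit_grade G (- k) i j \<notin> {..- (real P * e)}" for i j k
    proof -
      have "fls_nth (Z (p i j k + P) $ i $ j) k = fls_nth (Z P $ i $ j) k"
        by (rule stable) (use that in auto)
      moreover have "fls_nth (Z (p i j k + P) $ i $ j) k = fls_nth (S $ i $ j) k"
        unfolding S_nth by (rule stable[OF p]) simp
      ultimately show ?thesis by simp
    qed
    then show ?thesis
      by (simp add: graded_in_def)
  qed
  have "(mat 1 + M) ** S - mat 1 = 0"
  proof (rule loop_eq_0_if_arbitrarily_negative[OF e(1)])
    fix P :: nat
    have "graded_in G {..- (real P * e)} (M ** (S - Z P))"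
      by (rule graded_in_mult[OF M S_Z]) auto
    moreover have "graded_in G {..- (real P * e)} (S - Z (Suc P))"
      by (rule graded_in_mono[OF S_Z]) (use e(1) in auto)
    \<comment> \<open>Substituting \<open>mat 1 = Z (Suc P) + M ** Z P\<close> expresses the defect
      through the two approximation errors, both of grade at most
      \<open>- (real P * e)\<close>.\<close>
    moreover have "(mat 1 + M) ** S - mat 1 = (S - Z (Suc P)) + M ** (S - Z P)"
      by (simp add: Z_Suc matrix_ring_simps)
    ultimately show "graded_in G {..- (real P * e)} ((mat 1 + M) ** S - mat 1)"
      by (simp only: graded_in_add)
  qed
  then have inv: "(mat 1 + M) ** S = mat 1"
    by simp
  have "graded_in G {..0} S"
    using S_Z[of 0] by (simp add: Z_def)
  then have "graded_in G {..<0} (M ** S)"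
    by (rule graded_in_mult[OF M]) auto
  moreover have "S - mat 1 = - (M ** S)"
    using inv by (simp add: matrix_ring_simps algebra_simps)
  ultimately have "graded_in G {..<0} (S - mat 1)"
    by (simp only: graded_in_uminus)
  with inv that show ?thesis by blast
qed

text \<open>The right inverse \<open>S\<close> again has the form one plus negative grades, so it
  has a right inverse \<open>U\<close>; associativity forces \<open>U = mat 1 + M\<close>, which
  makes \<open>S\<close> two-sided.\<close>

lemma invertible_one_plus_negative:
  fixes M :: "('a::comm_ring_1, 'n::finite) loop"
  assumes "loop_deg G > 0" "graded_in G {..<0} M"
  shows "invertible (mat 1 + M)"
proof -
  obtain S where S: "(mat 1 + M) ** S = mat 1" "graded_in G {..<0} (S - mat 1)"
    using right_inverse_one_plus_negative[OF assms] by blast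
  obtain U where "S ** U = mat 1"
    using right_inverse_one_plus_negative[OF assms(1) S(2)] by auto
  moreover have "U = mat 1 + M"
    using S(1) \<open>S ** U = mat 1\<close> by (metis matrix_mul_assoc matrix_mul_lid matrix_mul_rid)
  ultimately show ?thesis
    using S(1) by (auto simp: invertible_def)
qed

text \<open>In the exponential series only the term \<open>p = 0\<close> has a component of
  nonnegative grade, so \<open>\<Theta>\<close> is one plus negative grades.\<close>

lemma invertible_dressing_op:
  fixes \<Theta> :: "('a::comm_complex_algebra, 'n::finite) loop"
  assumes "loop_deg G > 0" "dressing_op G \<Theta>"
  shows "invertible \<Theta>"
proof -
  obtain \<theta> where \<theta>: "neg_part G \<theta> = \<theta>" "is_exp \<theta> \<Theta>"
    using assms(2) by (auto simp: dressing_op_def)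
  have pow: "graded_in G {..<0} (loop_pow \<theta> p)" if "p > 0" for p
    using graded_in_loop_pow[OF _ that] \<theta>(1) by (simp add: graded_in_iff)
  have "graded_in G {..<0} (\<Theta> - mat 1)"
    unfolding graded_in_def
  proof (intro allI impI)
    fix i j k assume ijk: "unit_grade G (- k) i j \<notin> {..<0}"
    obtain P where "\<And>Q. Q \<ge> P \<Longrightarrow> fls_nth (\<Theta> $ i $ j) k =
        (\<Sum>p<Q. of_complex (1 / fact p) * fls_nth (loop_pow \<theta> p $ i $ j) k)"
      using \<theta>(2) unfolding is_exp_def eventually_sequentially by blast
    \<comment> \<open>The successor ensures that the partial sum contains the term
      \<open>p = 0\<close>, which is split off as the identity.\<close>
    from this[of "Suc P"] have "fls_nth (\<Theta> $ i $ j) k =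
        fls_nth ((mat 1 :: ('a, 'n) loop) $ i $ j) k +
        (\<Sum>p<P. of_complex (1 / fact (Suc p)) * fls_nth (loop_pow \<theta> (Suc p) $ i $ j) k)"
      by (simp add: sum.lessThan_Suc_shift loop_pow_def of_complex_1 del: sum.lessThan_Suc funpow.simps fact_Suc)
    moreover have "fls_nth (loop_pow \<theta> (Suc p) $ i $ j) k = 0" for p
      using pow[of "Suc p"] ijk by (simp add: graded_in_def)
    ultimately show "fls_nth ((\<Theta> - mat 1) $ i $ j) k = 0"
      by simp
  qed
  from invertible_one_plus_negative[OF assms(1) this] show ?thesis
    by simp
qed

section \<open>Coefficientwise maps of loops\<close>

lemma fls_times_nth_bounds:
  fixes f g :: "'a::semiring_0 fls"
  assumes "a \<le> fls_subdegree f" "b \<le> fls_subdegree g"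
  shows "fls_nth (f * g) k = (\<Sum>l=a..k - b. fls_nth f l * fls_nth g (k - l))"
  unfolding fls_times_nth(2)
  by (rule sum.mono_neutral_left) (use assms in \<open>auto simp: not_le\<close>)

text \<open>Any lower bounds of the supports are allowed because a coefficientwise map can kill
  leading coefficients and so change the subdegree; with common bounds, a series and its image are
  summed over the same range.\<close>

lemma fls_times_nth_outer:
  fixes f g :: "'a::semiring_0 fls"
  assumes "\<And>l. l < a \<Longrightarrow> fls_nth f l = 0" "\<And>l. l < b \<Longrightarrow> fls_nth g l = 0"
  shows "fls_nth (f * g) k = (\<Sum>l=a..k - b. fls_nth f l * fls_nth g (k - l))"
proof -
  \<comment> \<open>The minima cover the zero series, whose subdegree is 0 by convention and may lie
    below the given bound.\<close>
  have "fls_nth (f * g) k =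
      (\<Sum>l=min a (fls_subdegree f)..k - min b (fls_subdegree g). fls_nth f l * fls_nth g (k - l))"
    by (rule fls_times_nth_bounds) auto
  also have "\<dots> = (\<Sum>l=a..k - b. fls_nth f l * fls_nth g (k - l))"
    by (rule sum.mono_neutral_right) (use assms in \<open>auto simp: not_le\<close>)
  finally show ?thesis .
qed

lemma loop_support_bound:
  fixes Y :: "('a::zero, 'n::finite) loop"
  obtains a where "\<And>i j k. k < a \<Longrightarrow> fls_nth (Y $ i $ j) k = 0"
proof
  fix i j k
  assume "k < Min (range (\<lambda>(i, j). fls_subdegree (Y $ i $ j)))"
  moreover have "Min (range (\<lambda>(i, j). fls_subdegree (Y $ i $ j))) \<le> fls_subdegree (Y $ i $ j)"
    by (rule Min_le) (auto intro: rev_image_eqI[of "(i, j)"])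
  ultimately show "fls_nth (Y $ i $ j) k = 0"
    by simp
qed

lemma matrix_mult_nth:
  fixes Y Z :: "('a::comm_ring_1, 'n::finite) loop"
  assumes "\<And>i j k. k < a \<Longrightarrow> fls_nth (Y $ i $ j) k = 0" "\<And>i j k. k < b \<Longrightarrow> fls_nth (Z $ i $ j) k = 0"
  shows "fls_nth ((Y ** Z) $ i $ j) k =
    (\<Sum>m\<in>UNIV. \<Sum>l=a..k - b. fls_nth (Y $ i $ m) l * fls_nth (Z $ m $ j) (k - l))"
  by (simp add: matrix_matrix_mult_def fls_nth_sum fls_times_nth_outer[OF assms])

lemma cst_mult: "cst (X ** Y) = cst X ** (cst Y :: ('a::comm_complex_algebra, 'n::finite) loop)"
proof -
  obtain a where a: "\<And>i j k. k < a \<Longrightarrow> fls_nth (X $ i $ j) k = 0"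
    using loop_support_bound[of X] by blast
  obtain b where b: "\<And>i j k. k < b \<Longrightarrow> fls_nth (Y $ i $ j) k = 0"
    using loop_support_bound[of Y] by blast
  have sum: "of_complex (sum f S) = (\<Sum>x\<in>S. of_complex (f x) :: 'a)" for f and S :: "'s set"
    by (induction S rule: infinite_finite_induct) (simp_all add: of_complex_add)
  show ?thesis
    by (simp add: vec_eq_iff fls_eq_iff matrix_mult_nth[of a _ b] a b sum of_complex_mult)
qed

lemma cst_diff: "cst (X - Y) = cst X - (cst Y :: ('a::comm_complex_algebra, 'n::finite) loop)"
  by (simp add: vec_eq_iff fls_eq_iff diff_conv_add_uminus of_complex_add of_complex_minus
    del: add_uminus_conv_diff)

lemma cst_0 [simp]: "cst 0 = (0 :: ('a::comm_complex_algebra, 'n::finite) loop)"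
  by (simp add: vec_eq_iff fls_eq_iff)

section \<open>Derivations of the coefficient ring and their action on dressed elements\<close>

context
  fixes d :: "'a::comm_complex_algebra \<Rightarrow> 'a"
  assumes d: "is_derivation d"
begin

lemma derivation_add: "d (u + v) = d u + d v"
  and derivation_mult: "d (u * v) = d u * v + u * d v"
  and derivation_of_complex: "d (of_complex c) = 0"
  using d by (simp_all add: is_derivation_def)

lemma derivation_0: "d 0 = 0"
  using derivation_of_complex[of 0] by simp

lemma derivation_minus: "d (- u) = - d u"
  using derivation_add[of "- u" u] by (simp add: derivation_0 eq_neg_iff_add_eq_0)

lemma derivation_sum: "d (sum f S) = (\<Sum>x\<in>S. d (f x))"
  by (induction S rule: infinite_finite_induct) (simp_all add: derivation_add derivation_0)

lemma map_loop_derivation_diff: "map_loop d (Y - Z) = map_loop d Y - map_loop d (Z :: (_, 'n::finite) loop)"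
  by (simp add: vec_eq_iff fls_eq_iff derivation_0 derivation_add derivation_minus
    diff_conv_add_uminus del: add_uminus_conv_diff)

lemma map_loop_derivation_cst: "map_loop d (cst X :: (_, 'n::finite) loop) = 0"
  by (simp add: vec_eq_iff fls_eq_iff derivation_0 derivation_of_complex)

lemma map_loop_derivation_mat_1: "map_loop d (mat 1 :: (_, 'n::finite) loop) = 0"
  using derivation_of_complex[of 1]
  by (simp add: vec_eq_iff fls_eq_iff mat_def derivation_0 of_complex_1)

lemma map_loop_derivation_mult:
  fixes Y Z :: "('a, 'n::finite) loop"
  shows "map_loop d (Y ** Z) = map_loop d Y ** Z + Y ** map_loop d Z"
proof -
  obtain a where a: "\<And>i j k. k < a \<Longrightarrow> fls_nth (Y $ i $ j) k = 0"
    using loop_support_bound[of Y] by blast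
  obtain b where b: "\<And>i j k. k < b \<Longrightarrow> fls_nth (Z $ i $ j) k = 0"
    using loop_support_bound[of Z] by blast
  show ?thesis
    by (simp add: vec_eq_iff fls_eq_iff matrix_mult_nth[of a _ b] a b derivation_0
      derivation_sum derivation_mult sum.distrib)
qed

lemma map_loop_derivation_lie:
  "map_loop d (lie Y Z) = lie (map_loop d Y) Z + lie Y (map_loop d (Z :: (_, 'n::finite) loop))"
  by (simp add: lie_def map_loop_derivation_diff map_loop_derivation_mult)

text \<open>The grade of a coefficient depends on its position only, and a derivation does not move
  coefficients; hence flows respect the splitting into nonnegative and negative parts.\<close>

lemma map_loop_derivation_grade_part:
  "map_loop d (grade_part G S Y) = grade_part G S (map_loop d (Y :: (_, 'n::finite) loop))"
  by (simp add: vec_eq_iff fls_eq_iff derivation_0)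

text \<open>The spanning matrices are constant, so by the Leibniz rule only the coefficient
  functions \<open>f X\<close> are differentiated.\<close>

lemma map_loop_derivation_Ghat:
  fixes Y :: "('a, 'n::finite) loop"
  assumes "Y \<in> Ghat G"
  shows "map_loop d Y \<in> Ghat G"
proof -
  have "loop_coeff (map_loop d Y) k \<in> coeff_span (twist_eigenspace G k)" for k
  proof -
    obtain F f where F: "finite F" "F \<subseteq> twist_eigenspace G k"
      "loop_coeff Y k = (\<Sum>X\<in>F. mscale (f X) (\<chi> i j. of_complex (X $ i $ j)))"
      using assms unfolding Ghat_def coeff_span_def by blast
    have "loop_coeff (map_loop d Y) k = (\<chi> i j. d (loop_coeff Y k $ i $ j))"
      by (simp add: loop_coeff_def derivation_0)
    also have "\<dots> = (\<Sum>X\<in>F. mscale (d (f X)) (\<chi> i j. of_complex (X $ i $ j)))"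
      by (simp add: F(3) vec_eq_iff mscale_def derivation_sum derivation_mult derivation_of_complex)
    finally show ?thesis
      using F(1,2) unfolding coeff_span_def
      by (intro CollectI exI[of _ F] exI[of _ "\<lambda>X. d (f X)"]) simp
  qed
  then show ?thesis
    by (simp add: Ghat_def)
qed

lemma map_loop_derivation_conj_by:
  fixes \<Theta> :: "('a, 'n::finite) loop"
  assumes "invertible \<Theta>" and W: "map_loop d \<Theta> = W ** \<Theta>"
  shows "map_loop d (conj_by \<Theta> X) = lie W (conj_by \<Theta> X)"
proof -
  note inv = invertible_matrix_inv[OF assms(1)]
  \<comment> \<open>Differentiating \<open>\<Theta> ** matrix_inv \<Theta> = mat 1\<close> yields
    the derivative \<open>- (matrix_inv \<Theta> ** W)\<close> of the inverse; \<open>X\<close> is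
    constant, so the Leibniz rule leaves a commutator with \<open>W\<close>.\<close>
  have "W ** (\<Theta> ** matrix_inv \<Theta>) + \<Theta> ** map_loop d (matrix_inv \<Theta>) = map_loop d (\<Theta> ** matrix_inv \<Theta>)"
    by (simp only: map_loop_derivation_mult W matrix_mul_assoc)
  then have "W + \<Theta> ** map_loop d (matrix_inv \<Theta>) = 0"
    by (simp add: inv(1) map_loop_derivation_mat_1)
  then have "matrix_inv \<Theta> ** W + (matrix_inv \<Theta> ** \<Theta>) ** map_loop d (matrix_inv \<Theta>) = 0"
    by (metis matrix_add_ldistrib matrix_mul_assoc matrix_mult_0(1))
  then have "map_loop d (matrix_inv \<Theta>) = - (matrix_inv \<Theta> ** W)"
    by (simp add: inv(2) eq_neg_iff_add_eq_0 add.commute)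
  then show ?thesis
    by (simp add: conj_by_def lie_def map_loop_derivation_mult map_loop_derivation_cst W
      matrix_ring_simps)
qed

end

lemma conj_by_lie:
  fixes \<Theta> :: "('a::comm_complex_algebra, 'n::finite) loop"
  assumes "invertible \<Theta>"
  shows "conj_by \<Theta> (lie X Y) = lie (conj_by \<Theta> X) (conj_by \<Theta> Y)"
proof -
  have "conj_by \<Theta> X ** conj_by \<Theta> Y = \<Theta> ** (cst X ** cst Y) ** matrix_inv \<Theta>" for X Y
  proof -
    have "conj_by \<Theta> X ** conj_by \<Theta> Y =
        \<Theta> ** cst X ** (matrix_inv \<Theta> ** \<Theta>) ** cst Y ** matrix_inv \<Theta>"
      by (simp add: conj_by_def matrix_mul_assoc)
    then show ?thesis
      by (simp add: invertible_matrix_inv[OF assms] matrix_mul_assoc)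
  qed
  then show ?thesis
    unfolding lie_def by (simp add: conj_by_def cst_diff cst_mult matrix_mult_diff_left matrix_mult_diff_right)
qed

section \<open>Closure of the kernel under the bracket\<close>

text \<open>For complex coefficients \<open>of_complex\<close> is the identity, so the span is an
  ordinary complex one; this turns membership in \<open>Ghat\<close> into an eigenspace condition on
  each coefficient.\<close>

lemma coeff_span_complex:
  fixes V :: "(complex ^ 'n::finite ^ 'n) set"
  assumes "0 \<in> V" "\<And>X Y. X \<in> V \<Longrightarrow> Y \<in> V \<Longrightarrow> X + Y \<in> V" "\<And>c X. X \<in> V \<Longrightarrow> mscale c X \<in> V"
  shows "coeff_span V = V"
proof
  show "coeff_span V \<subseteq> V"
  proof
    fix M :: "complex ^ 'n ^ 'n" assume "M \<in> coeff_span V"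
    then obtain F f where F: "finite F" "F \<subseteq> V" "M = (\<Sum>X\<in>F. mscale (f X) (\<chi> i j. of_complex (X $ i $ j)))"
      unfolding coeff_span_def by blast
    have "(\<Sum>X\<in>F. mscale (f X) X) \<in> V"
      using F(1,2) by (induction F) (auto intro: assms)
    then show "M \<in> V"
      by (simp add: F(3) of_complex_complex_def)
  qed
  show "V \<subseteq> coeff_span V"
  proof
    fix X assume "X \<in> V"
    then show "X \<in> coeff_span V"
      unfolding coeff_span_def
      by (intro CollectI exI[of _ "{X}"] exI[of _ "\<lambda>_. 1"])
         (simp add: mscale_def of_complex_complex_def)
  qed
qed

context
  fixes G :: "'n::finite affine"
  assumes G: "graded_affine G"
begin

lemma fin_alg_closed:
  shows "0 \<in> fin_alg G"
    and "X \<in> fin_alg G \<Longrightarrow> Y \<in> fin_alg G \<Longrightarrow> X + Y \<in> fin_alg G"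
    and "X \<in> fin_alg G \<Longrightarrow> Y \<in> fin_alg G \<Longrightarrow> lie X Y \<in> fin_alg G"
    and "X \<in> fin_alg G \<Longrightarrow> mscale c X \<in> fin_alg G"
  using G by (simp_all add: graded_affine_def simple_lie_algebra_def lie_algebra_def)

lemma twist_hom:
  shows "X \<in> fin_alg G \<Longrightarrow> Y \<in> fin_alg G \<Longrightarrow> twist G (X + Y) = twist G X + twist G Y"
    and "X \<in> fin_alg G \<Longrightarrow> Y \<in> fin_alg G \<Longrightarrow> twist G (lie X Y) = lie (twist G X) (twist G Y)"
    and "X \<in> fin_alg G \<Longrightarrow> twist G (mscale c X) = mscale c (twist G X)"
  using G by (simp_all add: graded_affine_def finite_order_aut_def)

lemma twist_eigenspace_0: "0 \<in> twist_eigenspace G k"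
proof -
  have "mscale 0 (0 :: complex ^ 'n ^ 'n) = 0" "mscale c (0 :: complex ^ 'n ^ 'n) = 0" for c
    by (simp_all add: vec_eq_iff mscale_def)
  moreover have "mscale 0 (twist G 0) = 0"
    by (simp add: vec_eq_iff mscale_def)
  ultimately show ?thesis
    using twist_hom(3)[of 0 0] fin_alg_closed(1) by (simp add: twist_eigenspace_def)
qed

lemma twist_eigenspace_add:
  "X \<in> twist_eigenspace G k \<Longrightarrow> Y \<in> twist_eigenspace G k \<Longrightarrow> X + Y \<in> twist_eigenspace G k"
  by (simp add: twist_eigenspace_def fin_alg_closed twist_hom)
     (simp add: vec_eq_iff mscale_def algebra_simps)

lemma twist_eigenspace_mscale: "X \<in> twist_eigenspace G k \<Longrightarrow> mscale c X \<in> twist_eigenspace G k"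
  by (simp add: twist_eigenspace_def fin_alg_closed twist_hom)
     (simp add: vec_eq_iff mscale_def algebra_simps)

text \<open>The twist preserves brackets, and its eigenvalues, being roots of unity, multiply by
  adding exponents.\<close>

lemma twist_eigenspace_lie:
  "X \<in> twist_eigenspace G k \<Longrightarrow> Y \<in> twist_eigenspace G l \<Longrightarrow> lie X Y \<in> twist_eigenspace G (k + l)"
  by (simp add: twist_eigenspace_def fin_alg_closed twist_hom lie_mscale cis_mult
    add_divide_distrib distrib_left)

lemma Ghat_complex_iff:
  "(Y :: (complex, 'n) loop) \<in> Ghat G \<longleftrightarrow> (\<forall>k. loop_coeff Y k \<in> twist_eigenspace G k)"
  by (simp add: Ghat_def coeff_span_complex twist_eigenspace_0 twist_eigenspace_add
    twist_eigenspace_mscale)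

lemma Ghat_lie:
  fixes X Y :: "(complex, 'n) loop"
  assumes "X \<in> Ghat G" "Y \<in> Ghat G"
  shows "lie X Y \<in> Ghat G"
  unfolding Ghat_complex_iff
proof
  fix k
  obtain a where a: "\<And>i j k. k < a \<Longrightarrow> fls_nth (X $ i $ j) k = 0"
    using loop_support_bound[of X] by blast
  obtain b where b: "\<And>i j k. k < b \<Longrightarrow> fls_nth (Y $ i $ j) k = 0"
    using loop_support_bound[of Y] by blast
  have XY: "loop_coeff (X ** Y) k = (\<Sum>l=a..- k - b. loop_coeff X (- l) ** loop_coeff Y (k + l))"
    by (simp add: vec_eq_iff loop_coeff_def matrix_mult_nth[of a _ b] a b)
       (simp add: matrix_matrix_mult_def loop_coeff_def sum.swap[of _ UNIV] algebra_simps)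
  have "loop_coeff (Y ** X) k = (\<Sum>l=b..- k - a. loop_coeff Y (- l) ** loop_coeff X (k + l))"
    by (simp add: vec_eq_iff loop_coeff_def matrix_mult_nth[of b _ a] a b)
       (simp add: matrix_matrix_mult_def loop_coeff_def sum.swap[of _ UNIV] algebra_simps)
  \<comment> \<open>Reindexing by \<open>- k - l\<close> aligns the two convolutions so that their
    difference is a sum of brackets; \<open>fin_alg G\<close> is closed under brackets, not
    necessarily under products.\<close>
  also have "\<dots> = (\<Sum>l=a..- k - b. loop_coeff Y (k + l) ** loop_coeff X (- l))"
    by (rule sum.reindex_bij_witness[of _ "\<lambda>l. - k - l" "\<lambda>l. - k - l"]) (auto simp: add.commute)
  finally have "loop_coeff (lie X Y) k =
      (\<Sum>l=a..- k - b. lie (loop_coeff X (- l)) (loop_coeff Y (k + l)))"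
    unfolding lie_def sum_subtractf XY[symmetric] by (simp add: loop_coeff_def vec_eq_iff)
  moreover have "lie (loop_coeff X (- l)) (loop_coeff Y (k + l)) \<in> twist_eigenspace G k" for l
    using twist_eigenspace_lie[of "loop_coeff X (- l)" "- l" "loop_coeff Y (k + l)" "k + l"] assms
    by (simp add: Ghat_complex_iff)
  then have "(\<Sum>l\<in>S. lie (loop_coeff X (- l)) (loop_coeff Y (k + l))) \<in> twist_eigenspace G k" for S
    by (induction S rule: infinite_finite_induct) (simp_all add: twist_eigenspace_0 twist_eigenspace_add)
  ultimately show "loop_coeff (lie X Y) k \<in> twist_eigenspace G k"
    by simp
qed

text \<open>Grades add, and the Jacobi identity keeps the bracket in the kernel. This makes the flow
  of \<open>lie X Y\<close> available in the closure statement.\<close>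

lemma K_space_lie:
  assumes X: "X \<in> K_space G E m" and Y: "Y \<in> K_space G E n"
  shows "lie X Y \<in> K_space G E (m + n)"
proof -
  have "graded_in G {of_int (m + n)} (lie X Y)"
    by (rule graded_in_lie[of G "{of_int m}" _ "{of_int n}"])
       (use X Y in \<open>auto simp: K_space_def grade_space_iff\<close>)
  moreover have "lie E (lie X Y) = 0"
    using X Y by (subst lie_jacobi) (simp add: K_space_def Ker_ad_def lie_0)
  ultimately show ?thesis
    using X Y Ghat_lie by (simp add: K_space_def Ker_ad_def grade_space_iff)
qed

end

lemma K_space_subset_K_nonneg:
  assumes "m \<ge> 0" "X \<in> K_space G E m"
  shows "X \<in> K_nonneg G E"
proof -
  have "graded_in G {0..} X"
    using assms graded_in_mono[of G "{of_int m}" X "{0..}"] by (simp add: K_space_def grade_space_iff)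
  then show ?thesis
    using assms by (simp add: K_nonneg_def K_space_def graded_in_iff)
qed

section \<open>Zero curvature\<close>

text \<open>The first two brackets contain both mixed terms but count the bracket of the negative
  parts twice; the third term corrects this, and the last supplies the remaining bracket.\<close>

lemma lie_split:
  fixes P Q :: "('a::comm_ring_1, 'n::finite) loop"
  shows "lie P Q = lie (neg_part G P) Q - lie (neg_part G Q) P - lie (neg_part G P) (neg_part G Q)
    + lie (pos_part G P) (pos_part G Q)"
proof -
  have "lie (b + n) (b' + n') = lie n (b' + n') - lie n' (b + n) - lie n n' + lie b b'"
    for b n b' n' :: "('a, 'n) loop"
    using lie_skew[of n' b] lie_skew[of n' n] by (simp add: lie_add_left lie_add_right)
  from this[of "pos_part G P" "neg_part G P" "pos_part G Q" "neg_part G Q"] show ?thesis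
    by (simp only: pos_part_plus_neg_part)
qed

lemma graded_in_lie_pos: "graded_in G {0..} (lie (pos_part G P) (pos_part G Q))"
  and graded_in_lie_neg: "graded_in G {..<0} (lie (neg_part G P) (neg_part G Q))"
  for P Q :: "('a::comm_ring_1, 'n::finite) loop"
  by (rule graded_in_lie[OF graded_in_grade_part graded_in_grade_part]; simp)+

lemma neg_part_lie_pos: "neg_part G (lie (pos_part G P) (pos_part G Q)) = 0"
  and pos_part_lie_neg: "pos_part G (lie (neg_part G P) (neg_part G Q)) = 0"
  and neg_part_lie_neg: "neg_part G (lie (neg_part G P) (neg_part G Q)) = lie (neg_part G P) (neg_part G Q)"
  and pos_part_lie_pos: "pos_part G (lie (pos_part G P) (pos_part G Q)) = lie (pos_part G P) (pos_part G Q)"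
  for P Q :: "('a::comm_ring_1, 'n::finite) loop"
  using graded_in_lie_pos[of G P Q] graded_in_lie_neg[of G P Q]
  by (auto simp: graded_in_iff[symmetric] intro: grade_part_eq_0)

text \<open>Projecting \<open>lie_split\<close> to negative grades kills the bracket of the
  nonnegative parts and leaves that of the negative parts intact.\<close>

lemma neg_part_lie:
  fixes P Q :: "('a::comm_ring_1, 'n::finite) loop"
  shows "neg_part G (lie P Q) =
    neg_part G (lie (neg_part G P) Q) - neg_part G (lie (neg_part G Q) P)
    - lie (neg_part G P) (neg_part G Q)"
  by (subst lie_split[of P Q G])
     (simp add: grade_part_add grade_part_diff neg_part_lie_pos neg_part_lie_neg)

lemma pos_part_lie:
  fixes P Q :: "('a::comm_ring_1, 'n::finite) loop"
  shows "pos_part G (lie P Q) =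
    pos_part G (lie (neg_part G P) Q) - pos_part G (lie (neg_part G Q) P)
    + lie (pos_part G P) (pos_part G Q)"
  by (subst lie_split[of P Q G])
     (simp add: grade_part_add grade_part_diff pos_part_lie_pos pos_part_lie_neg)

text \<open>The second derivative has one term from differentiating the negative part and one from
  differentiating \<open>\<Theta>\<close>. After antisymmetrization the latter give minus the
  bracket of the negative parts, exactly the correction in \<open>neg_part_lie\<close>.\<close>

lemma dressing_flows_commutator:
  fixes \<Theta> :: "('a::comm_complex_algebra, 'n::finite) loop"
  assumes inv: "invertible \<Theta>" and d: "is_derivation d" "is_derivation d'"
    and X: "map_loop d \<Theta> = neg_part G (conj_by \<Theta> X) ** \<Theta>"
    and Y: "map_loop d' \<Theta> = neg_part G (conj_by \<Theta> Y) ** \<Theta>"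
  shows "map_loop d (map_loop d' \<Theta>) - map_loop d' (map_loop d \<Theta>) =
    neg_part G (conj_by \<Theta> (lie X Y)) ** \<Theta>"
proof -
  have "map_loop d (map_loop d' \<Theta>) =
      neg_part G (lie (neg_part G (conj_by \<Theta> X)) (conj_by \<Theta> Y)) ** \<Theta>
      + neg_part G (conj_by \<Theta> Y) ** (neg_part G (conj_by \<Theta> X) ** \<Theta>)"
    by (simp add: Y map_loop_derivation_mult[OF d(1)] map_loop_derivation_grade_part[OF d(1)]
      map_loop_derivation_conj_by[OF d(1) inv X] X)
  moreover have "map_loop d' (map_loop d \<Theta>) =
      neg_part G (lie (neg_part G (conj_by \<Theta> Y)) (conj_by \<Theta> X)) ** \<Theta>
      + neg_part G (conj_by \<Theta> X) ** (neg_part G (conj_by \<Theta> Y) ** \<Theta>)"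
    by (simp add: X map_loop_derivation_mult[OF d(2)] map_loop_derivation_grade_part[OF d(2)]
      map_loop_derivation_conj_by[OF d(2) inv Y] Y)
  ultimately show ?thesis
    by (simp add: conj_by_lie[OF inv] neg_part_lie[of G "conj_by \<Theta> X"] lie_def[of "neg_part G _" "neg_part G _"]
      matrix_ring_simps)
qed

text \<open>The flow \<open>\<delta> X\<close> is a derivation of the coefficient ring, prescribed
  only on \<open>\<Theta>\<close>; its action on \<open>A\<close> is derived from the dressing
  equation.\<close>

theorem lemma3p2:
  fixes G :: "'n::finite affine"
    and E :: "(complex, 'n) loop"
    and A \<Theta> :: "('r::comm_complex_algebra, 'n) loop"
    and D :: "'r \<Rightarrow> 'r"
    and \<delta> :: "(complex, 'n) loop \<Rightarrow> 'r \<Rightarrow> 'r"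
    and T :: "int set"
    and b :: "int \<Rightarrow> (complex, 'n) loop"
  assumes "graded_affine G"
    and "E \<in> grade_space G 1" and "semisimple_elem G E"
    and "is_derivation D"
    and "A \<in> M_space G E 0"
    and "dressing_op G \<Theta>"
    and "map_loop D \<Theta> = \<Theta> ** cst E - (cst E + A) ** \<Theta>"
    and "\<And>X. X \<in> K_nonneg G E \<Longrightarrow> is_derivation (\<delta> X)"
    and "\<And>X Y u. X \<in> K_nonneg G E \<Longrightarrow> Y \<in> K_nonneg G E \<Longrightarrow> \<delta> (X + Y) u = \<delta> X u + \<delta> Y u"
    and "\<And>c X u. X \<in> K_nonneg G E \<Longrightarrow> \<delta> (mscale (fls_const c) X) u = of_complex c * \<delta> X u"
    and "\<And>m X. m \<ge> 0 \<Longrightarrow> X \<in> K_space G E m \<Longrightarrow>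
           map_loop (\<delta> X) \<Theta> = neg_part G (conj_by \<Theta> X) ** \<Theta>"
    and "T \<subseteq> {0<..}" and "1 \<in> T"
    and "\<And>N. N \<in> T \<Longrightarrow> b N \<in> center_space G E N"
    and "b 1 = E" and "\<delta> (b 1) = D"
  shows "(\<forall>m\<ge>0. \<forall>X\<in>K_space G E m.
           map_loop (\<delta> X) A = lax_bracket D E A (pos_part G (conj_by \<Theta> X))) \<and>
         (\<forall>m\<ge>0. \<forall>X\<in>K_space G E m. map_loop (\<delta> X) A \<in> M_space G E 0) \<and>
         (\<forall>m\<ge>0. \<forall>X\<in>K_space G E m. \<forall>N\<in>T.
           map_loop (\<delta> X) (map_loop (\<delta> (b N)) \<Theta>) - map_loop (\<delta> (b N)) (map_loop (\<delta> X) \<Theta>) = 0) \<and>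
         (\<forall>m\<ge>0. \<forall>n\<ge>0. \<forall>X\<in>K_space G E m. \<forall>Y\<in>K_space G E n.
           map_loop (\<delta> X) (map_loop (\<delta> Y) \<Theta>) - map_loop (\<delta> Y) (map_loop (\<delta> X) \<Theta>)
             = map_loop (\<delta> (lie X Y)) \<Theta>)"
proof -
  note G = assms(1)
  have inv: "invertible \<Theta>"
    using assms(1,6) by (intro invertible_dressing_op) (simp_all add: graded_affine_def)
  have der: "is_derivation (\<delta> X)" if "m \<ge> 0" "X \<in> K_space G E m" for X m
    using assms(8) K_space_subset_K_nonneg[OF that] by blast
  have E: "E \<in> K_space G E 1"
    using assms(14)[of 1] assms(13,15) by (simp add: center_space_def)
  have \<delta>E: "\<delta> E = D"
    using assms(15,16) by simp
  note flow = assms(11)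
  \<comment> \<open>The derivative in x is itself a dressing flow, that of \<open>E\<close>, so the
    general flow lemmas apply to it.\<close>
  have D_flow: "map_loop D \<Theta> = neg_part G (conj_by \<Theta> E) ** \<Theta>"
    using flow[OF _ E] by (simp add: \<delta>E)
  have "conj_by \<Theta> E ** \<Theta> = \<Theta> ** cst E"
    by (simp add: conj_by_def matrix_mul_assoc[symmetric] invertible_matrix_inv[OF inv])
  \<comment> \<open>The dressing equation and the flow of \<open>E\<close> give two expressions for
    \<open>map_loop D \<Theta>\<close>; comparing them and cancelling the invertible
    \<open>\<Theta>\<close> identifies \<open>cst E + A\<close>.\<close>
  with D_flow assms(7) have "(cst E + A) ** \<Theta> = (conj_by \<Theta> E - neg_part G (conj_by \<Theta> E)) ** \<Theta>"
    unfolding matrix_mult_diff_left by (simp add: algebra_simps)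
  also have "conj_by \<Theta> E - neg_part G (conj_by \<Theta> E) = pos_part G (conj_by \<Theta> E)"
    using pos_part_plus_neg_part[of G "conj_by \<Theta> E"] by (simp add: algebra_simps)
  finally have pos_E: "pos_part G (conj_by \<Theta> E) = cst E + A"
    by (metis inv invertible_matrix_inv(1) matrix_mul_assoc matrix_mul_rid)

  have closed: "map_loop (\<delta> X) (map_loop (\<delta> Y) \<Theta>) - map_loop (\<delta> Y) (map_loop (\<delta> X) \<Theta>) =
      neg_part G (conj_by \<Theta> (lie X Y)) ** \<Theta>"
    if "m \<ge> 0" "X \<in> K_space G E m" "n \<ge> 0" "Y \<in> K_space G E n" for X Y m n
    using that by (intro dressing_flows_commutator[OF inv] der flow)

  have "map_loop (\<delta> X) A = lax_bracket D E A (pos_part G (conj_by \<Theta> X))"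
    if "m \<ge> 0" "X \<in> K_space G E m" for m X
  proof -
    note d = der[OF that]
    have "lie (conj_by \<Theta> E) (conj_by \<Theta> X) = conj_by \<Theta> (lie E X)"
      by (simp add: conj_by_lie[OF inv])
    also have "\<dots> = 0"
      using that(2) by (simp add: K_space_def Ker_ad_def conj_by_def matrix_mult_0)
    \<comment> \<open>Nonnegative part of the vanishing bracket of the dressed \<open>E\<close> and
      \<open>X\<close>: the left side will be the variation of \<open>A\<close>, the right side the
      Lax bracket.\<close>
    finally have "pos_part G (lie (neg_part G (conj_by \<Theta> X)) (conj_by \<Theta> E)) =
        pos_part G (lie (neg_part G (conj_by \<Theta> E)) (conj_by \<Theta> X))
        + lie (pos_part G (conj_by \<Theta> E)) (pos_part G (conj_by \<Theta> X))"
      using pos_part_lie[of G "conj_by \<Theta> E" "conj_by \<Theta> X"] by (simp add: grade_part_0 algebra_simps)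
    moreover have "map_loop (\<delta> X) A = pos_part G (lie (neg_part G (conj_by \<Theta> X)) (conj_by \<Theta> E))"
    proof -
      have "A = pos_part G (conj_by \<Theta> E) - cst E"
        by (simp add: pos_E)
      then show ?thesis
        by (simp only: map_loop_derivation_diff[OF d] map_loop_derivation_cst[OF d] diff_zero
          map_loop_derivation_grade_part[OF d] map_loop_derivation_conj_by[OF d inv flow[OF that]])
    qed
    moreover have "map_loop D (pos_part G (conj_by \<Theta> X)) =
        pos_part G (lie (neg_part G (conj_by \<Theta> E)) (conj_by \<Theta> X))"
      by (simp only: map_loop_derivation_grade_part[OF assms(4)]
        map_loop_derivation_conj_by[OF assms(4) inv D_flow])
    ultimately show ?thesis
      by (simp add: lax_bracket_def pos_E)
  qed
  moreover have "map_loop (\<delta> X) A \<in> M_space G E 0" if "m \<ge> 0" "X \<in> K_space G E m" for m X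
  proof -
    note d = der[OF that]
    \<comment> \<open>Since \<open>E\<close> is constant, differentiating the potential
      \<open>W\<close> exhibits the variation of \<open>A\<close> as an element of the image of ad
      \<open>E\<close>.\<close>
    obtain W where W: "W \<in> Ghat G" "A = lie (cst E) W"
      using assms(5) by (auto simp: M_space_def Im_ad_def)
    have "map_loop (\<delta> X) A = lie (cst E) (map_loop (\<delta> X) W)"
      by (simp add: W(2) map_loop_derivation_lie[OF d] map_loop_derivation_cst[OF d] lie_0)
    moreover have "graded_in G {of_int 0} (map_loop (\<delta> X) A)"
      using assms(5) derivation_0[OF d] by (simp add: M_space_def grade_space_iff graded_in_def)
    moreover have "map_loop (\<delta> X) A \<in> Ghat G"
      using assms(5) by (intro map_loop_derivation_Ghat[OF d]) (simp add: M_space_def grade_space_iff)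
    ultimately show ?thesis
      using map_loop_derivation_Ghat[OF d W(1)] by (simp add: M_space_def Im_ad_def grade_space_iff)
  qed
  moreover have "map_loop (\<delta> X) (map_loop (\<delta> (b N)) \<Theta>) - map_loop (\<delta> (b N)) (map_loop (\<delta> X) \<Theta>) = 0"
    if "m \<ge> 0" "X \<in> K_space G E m" "N \<in> T" for m X N
  proof -
    have N: "N \<ge> 0" "b N \<in> K_space G E N"
      using that(3) assms(12,14) by (auto simp: center_space_def)
    \<comment> \<open>Centrality of \<open>b N\<close> makes the commutator of the two flows the
      flow expression of the zero element.\<close>
    have "lie (b N) X = 0"
      using that assms(14) by (simp add: center_space_def K_space_def)
    then have "lie X (b N) = 0"
      using lie_skew[of X "b N"] by simp
    then show ?thesis
      using closed[OF that(1,2) N] by (simp add: conj_by_def matrix_mult_0 grade_part_0)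
  qed
  moreover have "map_loop (\<delta> X) (map_loop (\<delta> Y) \<Theta>) - map_loop (\<delta> Y) (map_loop (\<delta> X) \<Theta>)
      = map_loop (\<delta> (lie X Y)) \<Theta>"
    if "m \<ge> 0" "n \<ge> 0" "X \<in> K_space G E m" "Y \<in> K_space G E n" for m n X Y
    using closed[OF that(1,3,2,4)] flow[OF _ K_space_lie[OF G that(3,4)]] that(1,2) by simp
  ultimately show ?thesis
    by blast
qed

end
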